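(* For every non-negative integer $n$, $$\sum_{m\ge 0}\binom{m}{2}a_2(m,n)\ge\sum_{m\ge 0}\binom{m}{2}b_2(m,n).$$
   Context: A partition of $n$ is a non-increasing finite sequence of positive integers summing to $n$ (the empty partition is the unique partition of $0$). Its Young diagram has $\lambda_i$ left-justified cells in row $i$; with $\lambda'_j$ the number of cells in column $j$, the hook length of cell $(i,j)$ is $h(i,j)=\lambda_i+\lambda'_j-i-j+1$. $a_2(m,n)$ is the number of partitions of $n$ into odd parts whose Young diagram has exactly $m$ cells of hook length $2$; $b_2(m,n)$ is the number of partitions of $n$ into distinct parts whose Young diagram has exactly $m$ cells of hook length $2$. *)

theory Defs
  imports Complex_Main
begin

definition is_partition :: "nat \<Rightarrow> nat list \<Rightarrow> bool" where
  "is_partition n p \<longleftrightarrow> sorted_wrt (\<ge>) p \<and> 0 \<notin> set p \<and> sum_list p = n"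

text \<open>Rows and columns are numbered from 0.\<close>

definition cells :: "nat list \<Rightarrow> (nat \<times> nat) set" where
  "cells p = {(i, j). i < length p \<and> j < p ! i}"

definition col_length :: "nat list \<Rightarrow> nat \<Rightarrow> nat" where
  "col_length p j = card {i. (i, j) \<in> cells p}"

text \<open>
  With rows and columns numbered from 1, the hook length of the cell in row \<open>r\<close> and column \<open>c\<close>
  is \<open>p\<^sub>r + p'\<^sub>c - r - c + 1\<close>; substituting \<open>r = i + 1\<close> and \<open>c = j + 1\<close> turns the last three terms
  into \<open>- i - j - 1\<close>. On the cells of a partition \<open>j < p ! i\<close> and \<open>i < col_length p j\<close>, so the
  subtraction on natural numbers does not truncate.
\<close>

definition hook_length :: "nat list \<Rightarrow> nat \<Rightarrow> nat \<Rightarrow> nat" where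
  "hook_length p i j = p ! i + col_length p j - (i + j + 1)"

definition hook_count :: "nat \<Rightarrow> nat list \<Rightarrow> nat" where
  "hook_count k p = card {(i, j) \<in> cells p. hook_length p i j = k}"

definition a2 :: "nat \<Rightarrow> nat \<Rightarrow> nat" where
  "a2 m n = card {p. is_partition n p \<and> (\<forall>x\<in>set p. odd x) \<and> hook_count 2 p = m}"

definition b2 :: "nat \<Rightarrow> nat \<Rightarrow> nat" where
  "b2 m n = card {p. is_partition n p \<and> distinct p \<and> hook_count 2 p = m}"

text \<open>
  The facts below show that the cardinalities above are those of finite sets, and that series over
  \<open>m\<close> involving \<^term>\<open>a2 m n\<close> or \<^term>\<open>b2 m n\<close> have only finitely many nonzero terms.
\<close>

lemma cells_eq_Sigma: "cells p = (SIGMA i:{..<length p}. {..<p ! i})"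
  by (auto simp: cells_def)

lemma finite_cells: "finite (cells p)"
  by (simp add: cells_eq_Sigma)

lemma card_cells: "card (cells p) = sum_list p"
  by (simp add: cells_eq_Sigma sum_list_sum_nth atLeast0LessThan)

lemma hook_count_le: "hook_count k p \<le> sum_list p"
  unfolding hook_count_def card_cells[symmetric]
  by (rule card_mono[OF finite_cells]) auto

lemma less_col_length:
  assumes "sorted_wrt (\<ge>) p" "(i, j) \<in> cells p"
  shows "i < col_length p j"
proof -
  have "j < p ! i'" if "i' \<le> i" for i'
  proof (cases "i' = i")
    case False
    then have "p ! i' \<ge> p ! i"
      using that assms by (auto simp: cells_def sorted_wrt_iff_nth_less)
    then show ?thesis using assms by (auto simp: cells_def)
  qed (use assms in \<open>auto simp: cells_def\<close>)
  then have "{..i} \<subseteq> {i'. (i', j) \<in> cells p}"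
    using assms by (auto simp: cells_def)
  moreover have "finite {i'. (i', j) \<in> cells p}"
    by (rule finite_subset[of _ "{..<length p}"]) (auto simp: cells_def)
  ultimately have "card {..i} \<le> col_length p j"
    unfolding col_length_def by (intro card_mono)
  then show ?thesis by simp
qed

lemma length_le_sum_list: "0 \<notin> set p \<Longrightarrow> length p \<le> sum_list (p :: nat list)"
  by (induction p) auto

lemma finite_partitions: "finite {p. is_partition n p}"
proof (rule finite_subset)
  show "{p. is_partition n p} \<subseteq> {p. set p \<subseteq> {..n} \<and> length p \<le> n}"
    by (auto simp: is_partition_def member_le_sum_list length_le_sum_list)
  show "finite {p. set p \<subseteq> {..n} \<and> length p \<le> n}"
    by (rule finite_lists_length_le) simp
qed

lemma a2_eq_0:
  assumes "m > n"
  shows "a2 m n = 0"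
proof -
  have "\<not> (is_partition n p \<and> (\<forall>x\<in>set p. odd x) \<and> hook_count 2 p = m)" for p
    using assms hook_count_le[of 2 p] unfolding is_partition_def by linarith
  then show ?thesis unfolding a2_def by (simp only: empty_def[symmetric] card.empty)
qed

lemma b2_eq_0:
  assumes "m > n"
  shows "b2 m n = 0"
proof -
  have "\<not> (is_partition n p \<and> distinct p \<and> hook_count 2 p = m)" for p
    using assms hook_count_le[of 2 p] unfolding is_partition_def by linarith
  then show ?thesis unfolding b2_def by (simp only: empty_def[symmetric] card.empty)
qed

end

theory Submission
  imports Defs "HOL-Library.Multiset" "HOL-Computational_Algebra.Formal_Power_Series"
begin

text \<open>
  The number of cells of hook length two of a partition is the number of part sizes \<open>x \<ge> 2\<close> such
  that \<open>x - 1\<close> is not a part, plus the number of repeated part sizes. For distinct parts up to \<open>N\<close>,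
  removing the largest part gives a linear recursion for the generating function of the binomial
  moments of this statistic. Its solution for the second moment, combined with Euler's theorem
  on odd and distinct parts, shows that the right-hand side is the number of partitions of \<open>n - 6\<close>
  into parts that are odd or equal to 2 or 4. On the odd side, the parts 2 and 4 of such a
  partition are traded for a pair of odd parts \<open>3 \<le> x \<le> y\<close>, which determines two of the cells of
  hook length two.
\<close>

unbundle fps_syntax

subsection \<open>Cells of hook length two\<close>

text \<open>Rows do not lengthen downwards, so the rows meeting a column form an initial segment,
  whose size is the column length.\<close>

lemma col_length_iff:
  assumes "sorted_wrt (\<ge>) p"
  shows "(i, j) \<in> cells p \<longleftrightarrow> i < col_length p j"
proof
  assume "i < col_length p j"
  show "(i, j) \<in> cells p"
  proof (rule ccontr)
    assume no: "(i, j) \<notin> cells p"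
    have "{i'. (i', j) \<in> cells p} \<subseteq> {..<i}"
    proof
      fix i' assume i': "i' \<in> {i'. (i', j) \<in> cells p}"
      have "i' < i"
      proof (rule ccontr)
        assume "\<not> i' < i"
        then have "i' = i \<or> i < i'" by auto
        then have "p ! i \<ge> p ! i'" "i < length p"
          using i' assms by (auto simp: cells_def sorted_wrt_iff_nth_less)
        then show False using i' no by (auto simp: cells_def)
      qed
      then show "i' \<in> {..<i}" by simp
    qed
    then have "col_length p j \<le> card {..<i}"
      unfolding col_length_def by (intro card_mono) auto
    then show False using \<open>i < col_length p j\<close> by simp
  qed
qed (rule less_col_length[OF assms])

lemma count_ge_2_iff:
  "count (mset p) x \<ge> 2 \<longleftrightarrow> (\<exists>i k. i < k \<and> k < length p \<and> p ! i = x \<and> p ! k = x)"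
proof -
  let ?I = "{i. i < length p \<and> p ! i = x}"
  have card: "count (mset p) x = card ?I"
    by (simp add: count_mset count_list_eq_length_filter length_filter_conv_card eq_commute)
  show ?thesis
  proof
    assume "count (mset p) x \<ge> 2"
    then obtain T where "T \<subseteq> ?I" "card T = 2"
      using card obtain_subset_with_card_n by metis
    then obtain i k where "i \<noteq> k" "{i, k} \<subseteq> ?I" by (auto simp: card_2_iff)
    then show "\<exists>i k. i < k \<and> k < length p \<and> p ! i = x \<and> p ! k = x"
      by (metis (mono_tags, lifting) insert_subset linorder_neqE_nat mem_Collect_eq)
  next
    assume "\<exists>i k. i < k \<and> k < length p \<and> p ! i = x \<and> p ! k = x"
    then obtain i k where "i < k" "k < length p" "p ! i = x" "p ! k = x" by blast
    then have "{i, k} \<subseteq> ?I" "card {i, k} = 2" by auto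
    moreover from this(1) have "card {i, k} \<le> card ?I" by (intro card_mono) auto
    ultimately show "count (mset p) x \<ge> 2" using card by simp
  qed
qed

text \<open>A cell of hook length two has either arm one and leg zero or arm zero and leg one.\<close>

lemma hook_count_2:
  assumes "sorted_wrt (\<ge>) p" "0 \<notin> set p"
  shows "hook_count 2 p =
    card {x \<in> set p. x \<ge> 2 \<and> x - 1 \<notin> set p} + card {x. count (mset p) x \<ge> 2}"
proof -
  let ?c = "col_length p"
  let ?A = "{(i, j). i < length p \<and> j + 2 = p ! i \<and> ?c j = i + 1}"
  let ?B = "{(i, j). i < length p \<and> j + 1 = p ! i \<and> ?c j = i + 2}"
  have cell: "i < ?c j \<longleftrightarrow> i < length p \<and> j < p ! i" for i j
    using col_length_iff[OF assms(1), of i j] by (auto simp: cells_def)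
  have mono: "p ! k \<le> p ! i" if "i \<le> k" "k < length p" for i k
    using assms(1) that by (cases "i = k") (auto simp: sorted_wrt_iff_nth_less)
  have split: "{(i, j) \<in> cells p. hook_length p i j = 2} = ?A \<union> ?B"
  proof -
    have "(i, j) \<in> cells p \<and> hook_length p i j = 2 \<longleftrightarrow> (i, j) \<in> ?A \<union> ?B" for i j
      using cell[of i j] by (auto simp: cells_def hook_length_def)
    then show ?thesis by blast
  qed
  have fin: "finite ?A" "finite ?B"
    using finite_cells[of p] by (auto intro: finite_subset[rotated] simp: cells_def)
  have "bij_betw (\<lambda>(i, j). p ! i) ?A {x \<in> set p. x \<ge> 2 \<and> x - 1 \<notin> set p}"
    unfolding bij_betw_def
  proof
    \<comment> \<open>The value \<open>p ! i\<close> fixes \<open>j\<close>, and the length of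
      column \<open>j\<close> then fixes \<open>i\<close>.\<close>
    show "inj_on (\<lambda>(i, j). p ! i) ?A"
    proof (rule inj_onI)
      fix s t assume "s \<in> ?A" "t \<in> ?A" and eq: "(\<lambda>(i, j). p ! i) s = (\<lambda>(i, j). p ! i) t"
      then obtain i j i' j' where st: "s = (i, j)" "t = (i', j')"
        and "j + 2 = p ! i" "?c j = i + 1" "j' + 2 = p ! i'" "?c j' = i' + 1" by auto
      moreover from this eq have "j = j'" by simp
      ultimately show "s = t" by simp
    qed
    show "(\<lambda>(i, j). p ! i) ` ?A = {x \<in> set p. x \<ge> 2 \<and> x - 1 \<notin> set p}"
    proof (intro equalityI subsetI)
      fix x assume "x \<in> (\<lambda>(i, j). p ! i) ` ?A"
      then obtain i j where ij: "i < length p" "j + 2 = p ! i" "?c j = i + 1" "x = p ! i" by auto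
      have "x - 1 \<notin> set p"
      proof
        assume "x - 1 \<in> set p"
        then obtain k where k: "k < length p" "p ! k = x - 1" by (auto simp: in_set_conv_nth)
        then have "k < ?c j" using cell[of k j] ij by simp
        then have "k \<le> i" using ij by simp
        then show False using mono[of k i] k ij by simp
      qed
      then show "x \<in> {x \<in> set p. x \<ge> 2 \<and> x - 1 \<notin> set p}" using ij by auto
    next
      fix x assume x: "x \<in> {x \<in> set p. x \<ge> 2 \<and> x - 1 \<notin> set p}"
      then obtain i0 where i0: "i0 < length p" "p ! i0 = x" by (auto simp: in_set_conv_nth)
      \<comment> \<open>This is the last row of length at least \<open>x\<close>; as it is not above
        row \<open>i0\<close>, its length is exactly \<open>x\<close>.\<close>
      define i where "i = ?c (x - 1) - 1"
      have "i0 < ?c (x - 1)" using cell[of i0 "x - 1"] i0 x by simp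
      then have i: "i0 \<le> i" "i < ?c (x - 1)" "?c (x - 1) = i + 1" by (auto simp: i_def)
      then have len: "i < length p" and ge: "x - 1 < p ! i" using cell[of i "x - 1"] by auto
      have pi: "p ! i = x" using mono[OF i(1) len] ge i0 by simp
      have "i < ?c (x - 2)" using cell[of i "x - 2"] len pi x by simp
      \<comment> \<open>Otherwise row \<open>i + 1\<close> would reach column \<open>x - 2\<close>
        but not column \<open>x - 1\<close>, making \<open>x - 1\<close> a part.\<close>
      moreover have "\<not> i + 1 < ?c (x - 2)"
      proof
        assume "i + 1 < ?c (x - 2)"
        then have "i + 1 < length p" "x - 2 < p ! (i + 1)" using cell[of "i + 1" "x - 2"] by auto
        moreover have "\<not> i + 1 < ?c (x - 1)" using i by simp
        ultimately have "p ! (i + 1) = x - 1" using cell[of "i + 1" "x - 1"] by simp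
        then show False using x \<open>i + 1 < length p\<close> nth_mem[of "i + 1" p] by simp
      qed
      moreover have "x - 2 + 2 = x" using x by auto
      ultimately have "(i, x - 2) \<in> ?A" using len pi by simp
      then show "x \<in> (\<lambda>(i, j). p ! i) ` ?A" using pi by force
    qed
  qed
  then have cardA: "card ?A = card {x \<in> set p. x \<ge> 2 \<and> x - 1 \<notin> set p}"
    by (rule bij_betw_same_card)
  have "bij_betw (\<lambda>(i, j). p ! i) ?B {x. count (mset p) x \<ge> 2}"
    unfolding bij_betw_def
  proof
    show "inj_on (\<lambda>(i, j). p ! i) ?B"
    proof (rule inj_onI)
      fix s t assume "s \<in> ?B" "t \<in> ?B" and eq: "(\<lambda>(i, j). p ! i) s = (\<lambda>(i, j). p ! i) t"
      then obtain i j i' j' where st: "s = (i, j)" "t = (i', j')"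
        and "j + 1 = p ! i" "?c j = i + 2" "j' + 1 = p ! i'" "?c j' = i' + 2" by auto
      moreover from this eq have "j = j'" by simp
      ultimately show "s = t" by simp
    qed
    show "(\<lambda>(i, j). p ! i) ` ?B = {x. count (mset p) x \<ge> 2}"
    proof (intro equalityI subsetI)
      fix x assume "x \<in> (\<lambda>(i, j). p ! i) ` ?B"
      then obtain i j where ij: "i < length p" "j + 1 = p ! i" "?c j = i + 2" "x = p ! i" by auto
      then have "i + 1 < length p" "j < p ! (i + 1)" using cell[of "i + 1" j] by auto
      then have "p ! (i + 1) = x" using mono[of i "i + 1"] ij by simp
      then show "x \<in> {x. count (mset p) x \<ge> 2}"
        unfolding mem_Collect_eq count_ge_2_iff
        using ij \<open>i + 1 < length p\<close> by (intro exI[of _ i] exI[of _ "i + 1"]) simp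
    next
      fix x assume "x \<in> {x. count (mset p) x \<ge> 2}"
      then obtain i0 i1 where i01: "i0 < i1" "i1 < length p" "p ! i0 = x" "p ! i1 = x"
        unfolding mem_Collect_eq count_ge_2_iff by blast
      have "x \<in> set p" using i01 by auto
      then have pos: "x > 0" using assms(2) by (metis gr0I)
      \<comment> \<open>This is the last row but one of length at least \<open>x\<close>; since
        \<open>i0 < i1\<close> both have length \<open>x\<close>, it is not above row
        \<open>i0\<close>.\<close>
      define i where "i = ?c (x - 1) - 2"
      have "i1 < ?c (x - 1)" using cell[of i1 "x - 1"] i01 pos by simp
      then have i: "i0 \<le> i" "i < ?c (x - 1)" "?c (x - 1) = i + 2" using i01 by (auto simp: i_def)
      then have len: "i < length p" and ge: "x - 1 < p ! i" using cell[of i "x - 1"] by auto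
      have pi: "p ! i = x" using mono[OF i(1) len] ge i01 by simp
      then have "(i, x - 1) \<in> ?B" using len i pos by simp
      then show "x \<in> (\<lambda>(i, j). p ! i) ` ?B" using pi by force
    qed
  qed
  then have cardB: "card ?B = card {x. count (mset p) x \<ge> 2}" by (rule bij_betw_same_card)
  have "?A \<inter> ?B = {}" by auto
  then show ?thesis
    unfolding hook_count_def split by (simp only: card_Un_disjoint fin cardA cardB)
qed

subsection \<open>Partitions with parts from a finite set\<close>

definition parts_in :: "nat set \<Rightarrow> nat \<Rightarrow> nat multiset set" where
  "parts_in A n = {K. set_mset K \<subseteq> A \<and> sum_mset K = n}"

definition parts_fps :: "nat set \<Rightarrow> int fps" where
  "parts_fps A = Abs_fps (\<lambda>n. int (card (parts_in A n)))"

lemma finite_parts_in: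
  assumes "finite A" "0 \<notin> A"
  shows "finite (parts_in A n)"
proof (rule finite_subset)
  show "parts_in A n \<subseteq> mset ` {xs. set xs \<subseteq> A \<and> length xs \<le> n}"
  proof
    fix K assume K: "K \<in> parts_in A n"
    obtain xs where xs: "mset xs = K" using ex_mset by blast
    then have "set xs \<subseteq> A" "sum_list xs = n"
      using K by (auto simp: parts_in_def sum_mset_sum_list)
    moreover from this have "length xs \<le> n" using length_le_sum_list[of xs] assms by auto
    ultimately show "K \<in> mset ` {xs. set xs \<subseteq> A \<and> length xs \<le> n}" using xs by blast
  qed
  show "finite (mset ` {xs. set xs \<subseteq> A \<and> length xs \<le> n})"
    by (intro finite_imageI finite_lists_length_le assms)
qed

text \<open>A multiset either avoids \<open>a\<close> or arises from a unique smaller one by adding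
  one copy of \<open>a\<close>.\<close>

lemma card_parts_in_insert:
  assumes "finite A" "0 \<notin> A" "a > 0" "a \<notin> A"
  shows "card (parts_in (insert a A) n) =
    card (parts_in A n) + (if n < a then 0 else card (parts_in (insert a A) (n - a)))"
proof -
  let ?C = "if n < a then {} else add_mset a ` parts_in (insert a A) (n - a)"
  have fin: "finite (parts_in (insert a A) m)" for m
    using assms by (intro finite_parts_in) auto
  have "parts_in (insert a A) n = parts_in A n \<union> ?C"
  proof (intro equalityI subsetI)
    fix K assume K: "K \<in> parts_in (insert a A) n"
    show "K \<in> parts_in A n \<union> ?C"
    proof (cases "a \<in># K")
      case True
      then obtain L where L: "K = add_mset a L" by (blast dest: multi_member_split)
      then have "L \<in> parts_in (insert a A) (n - a)" "\<not> n < a"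
        using K by (auto simp: parts_in_def)
      then show ?thesis using L by auto
    next
      case False
      then show ?thesis using K by (auto simp: parts_in_def)
    qed
  qed (auto simp: parts_in_def split: if_splits)
  moreover have "parts_in A n \<inter> ?C = {}"
  proof -
    have "a \<notin># K" if "K \<in> parts_in A n" for K
      using that assms(4) by (auto simp: parts_in_def)
    moreover have "a \<in># K" if "K \<in> ?C" for K
      using that by (auto split: if_splits)
    ultimately show ?thesis by blast
  qed
  moreover have "card ?C = (if n < a then 0 else card (parts_in (insert a A) (n - a)))"
    by (cases "n < a") (simp_all add: card_image inj_on_def)
  moreover have "finite ?C" using fin by simp
  ultimately show ?thesis
    using finite_parts_in[OF assms(1,2), of n] by (simp only: card_Un_disjoint)
qed

text \<open>This is the usual product formula for the generating function, kept free of inverses. By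
  the recursion on parts, multiplying by \<open>1 - fps_X ^ a\<close> removes \<open>a\<close> from
  the permitted parts.\<close>

lemma parts_fps_times_prod:
  assumes "finite A" "0 \<notin> A"
  shows "parts_fps A * (\<Prod>a\<in>A. 1 - fps_X ^ a) = 1"
  using assms
proof (induction A rule: finite_induct)
  case empty
  have "parts_in {} n = (if n = 0 then {{#}} else {})" for n
    by (auto simp: parts_in_def)
  then show ?case by (auto simp: parts_fps_def fps_eq_iff)
next
  case (insert a A)
  then have "a > 0" by auto
  have "parts_fps (insert a A) * (1 - fps_X ^ a) = parts_fps A"
  proof (rule fps_ext)
    fix n
    have "(parts_fps (insert a A) * (1 - fps_X ^ a)) $ n =
      parts_fps (insert a A) $ n - (if n < a then 0 else parts_fps (insert a A) $ (n - a))"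
      by (simp add: right_diff_distrib fps_X_power_mult_right_nth)
    also have "\<dots> = parts_fps A $ n"
      using card_parts_in_insert[of A a n] insert \<open>a > 0\<close> by (auto simp: parts_fps_def)
    finally show "(parts_fps (insert a A) * (1 - fps_X ^ a)) $ n = parts_fps A $ n" .
  qed
  then have "parts_fps (insert a A) * (\<Prod>a\<in>insert a A. 1 - fps_X ^ a) =
      parts_fps A * (\<Prod>a\<in>A. 1 - fps_X ^ a)"
    unfolding prod.insert[OF insert.hyps] by (simp only: mult.assoc[symmetric])
  then show ?case using insert.IH insert.prems by (metis insertCI)
qed

subsection \<open>Power series congruent to one\<close>

text \<open>Congruence modulo \<open>fps_X ^ n\<close> replaces convergence of infinite products:
  multiplying by such a series leaves the coefficients below \<open>n\<close> unchanged.\<close>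

definition one_upto :: "nat \<Rightarrow> int fps \<Rightarrow> bool" where
  "one_upto n f \<longleftrightarrow> fps_X ^ n dvd f - 1"

lemma one_upto_mult:
  assumes "one_upto n f" "one_upto n g"
  shows "one_upto n (f * g)"
proof -
  have eq: "f * g - 1 = (f - 1) * g + (g - 1)" by (simp add: algebra_simps)
  show ?thesis
    using assms unfolding one_upto_def eq by (intro dvd_add dvd_mult2)
qed

lemma one_upto_prod: "(\<And>i. i \<in> I \<Longrightarrow> one_upto n (f i)) \<Longrightarrow> one_upto n (\<Prod>i\<in>I. f i)"
proof (induction I rule: infinite_finite_induct)
  case (insert x F)
  then show ?case by (simp add: one_upto_mult)
qed (simp_all add: one_upto_def)

lemma one_upto_one_minus_X_power: "n \<le> k \<Longrightarrow> one_upto n (1 - fps_X ^ k)"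
  by (simp add: one_upto_def le_imp_power_dvd)

lemma one_upto_mult_nth:
  assumes "one_upto n f" "i < n"
  shows "(g * f) $ i = g $ i"
proof -
  obtain h where "f - 1 = fps_X ^ n * h" using assms(1) by (auto simp: one_upto_def)
  then have "g * f = g + fps_X ^ n * (h * g)" by (simp add: algebra_simps)
  then show ?thesis using assms(2) by (simp add: fps_X_power_mult_nth)
qed

text \<open>A truncated form of Euler's theorem. Multiplying each \<open>1 + fps_X ^ k\<close> by
  \<open>1 - fps_X ^ k\<close> gives \<open>1 - fps_X ^ (2 * k)\<close>; the even factors up to
  \<open>2 * M\<close> cancel, and those left have exponent at least
  \<open>2 * M + 2\<close>.\<close>

lemma Euler_odd_distinct:
  "one_upto (2 * M + 1)
    ((\<Prod>k=1..2 * M. 1 + fps_X ^ k) * (\<Prod>i<M. 1 - fps_X ^ (2 * i + 1)))"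
proof -
  let ?q = "\<lambda>k. 1 - fps_X ^ k :: int fps"
  let ?D = "\<Prod>k=1..2 * M. 1 + fps_X ^ k :: int fps" and ?O = "\<Prod>i<M. ?q (2 * i + 1)"
  let ?c = "\<Prod>k=1..M. ?q (2 * k)" and ?r = "\<Prod>k=M+1..2 * M. ?q (2 * k)"
  have oe: "(\<Prod>k=1..2 * M. ?q k) = ?O * ?c"
    by (induction M) (simp_all add: algebra_simps)
  have pq: "(1 + fps_X ^ k) * ?q k = ?q (2 * k)" for k
    by (simp only: mult_2 power_add) (simp add: algebra_simps)
  have "?D * (\<Prod>k=1..2 * M. ?q k) = (\<Prod>k=1..2 * M. ?q (2 * k))"
    by (simp only: pq prod.distrib[symmetric])
  also have "\<dots> = ?c * ?r"
    using prod.ub_add_nat[of 1 M "\<lambda>k. ?q (2 * k)" M] by (simp add: mult_2)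
  finally have "?D * (?O * ?c) = ?c * ?r" unfolding oe .
  then have "?c * (?D * ?O) = ?c * ?r" by (simp only: mult_ac)
  moreover have "?c \<noteq> 0"
  proof -
    have "?q (2 * k) \<noteq> 0" if "k \<in> {1..M}" for k
    proof -
      have "?q (2 * k) $ 0 = 1" using that by (simp add: fps_X_power_nth)
      then show ?thesis by (metis fps_zero_nth zero_neq_one)
    qed
    then show ?thesis unfolding prod_zero_iff[OF finite_atLeastAtMost] by blast
  qed
  ultimately have "?D * ?O = ?r" by (metis mult_left_cancel)
  moreover have "one_upto (2 * M + 1) ?r"
    by (intro one_upto_prod one_upto_one_minus_X_power) auto
  ultimately show ?thesis by (simp only:)
qed

subsection \<open>Partitions into distinct parts\<close>

text \<open>The elements counted are the starts of maximal runs of consecutive integers, except for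
  a run starting below 2. For a set of distinct parts this is the number of cells of hook length
  two.\<close>

definition gap_starts :: "nat set \<Rightarrow> nat" where
  "gap_starts S = card {x \<in> S. x \<ge> 2 \<and> x - 1 \<notin> S}"

text \<open>Binomial rather than ordinary moments are used because Pascal's rule then makes the
  recursion in \<open>N\<close> linear with only two moments involved.\<close>

definition gap_fps :: "nat \<Rightarrow> nat \<Rightarrow> int fps" where
  "gap_fps N m = (\<Sum>S\<in>Pow {1..N}. of_nat (gap_starts S choose m) * fps_X ^ \<Sum>S)"

lemma sum_Pow_insert:
  assumes "finite A" "a \<notin> A"
  shows "(\<Sum>S\<in>Pow (insert a A). f S) = (\<Sum>S\<in>Pow A. f S) + (\<Sum>S\<in>Pow A. f (insert a S))"
proof -
  have "inj_on (insert a) (Pow A)" using assms(2)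
    by (intro inj_onI) (metis PowD insert_ident subsetD)
  then show ?thesis
    unfolding Pow_insert using assms by (subst sum.union_disjoint) (auto simp: sum.reindex)
qed

text \<open>A new maximum does not affect the status of smaller elements, and it starts a run
  exactly when its predecessor is absent. Writing it as \<open>N + 2\<close> guarantees that it is
  at least 2.\<close>

lemma gap_starts_insert:
  assumes "S \<subseteq> {1..Suc N}"
  shows "gap_starts (insert (N + 2) S) = gap_starts S + (if Suc N \<in> S then 0 else 1)"
proof -
  have fin: "finite S" using assms finite_subset by blast
  have "{x \<in> insert (N + 2) S. x \<ge> 2 \<and> x - 1 \<notin> insert (N + 2) S} =
    {x \<in> S. x \<ge> 2 \<and> x - 1 \<notin> S} \<union> (if Suc N \<in> S then {} else {N + 2})"
    using assms by (auto split: if_splits)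
  moreover have "N + 2 \<notin> S" using assms by auto
  ultimately show ?thesis using fin by (auto simp: gap_starts_def)
qed

text \<open>Split by whether \<open>N + 2\<close> belongs to the set. If it does, Pascal's rule
  yields an extra term only for sets without \<open>N + 1\<close>, that is, for subsets of
  \<open>{1..N}\<close>.\<close>

lemma gap_fps_Suc_Suc:
  "gap_fps (N + 2) (Suc m) =
    (1 + fps_X ^ (N + 2)) * gap_fps (N + 1) (Suc m) + fps_X ^ (N + 2) * gap_fps N m"
proof -
  let ?w = "\<lambda>S m. of_nat (gap_starts S choose m) * fps_X ^ \<Sum>S :: int fps"
  have A: "{1..N + 2} = insert (N + 2) {1..N + 1}" "{1..N + 1} = insert (N + 1) {1..N}" by auto
  have w: "?w (insert (N + 2) S) (Suc m) = fps_X ^ (N + 2) *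
      (?w S (Suc m) + (if N + 1 \<in> S then 0 else ?w S m))" if "S \<in> Pow {1..N + 1}" for S
  proof -
    have S: "finite S" "N + 2 \<notin> S" using that finite_subset by auto
    have "gap_starts (insert (N + 2) S) = gap_starts S + (if Suc N \<in> S then 0 else 1)"
      using that by (intro gap_starts_insert) simp
    then show ?thesis using S by (simp add: power_add algebra_simps)
  qed
  have drop: "(\<Sum>S\<in>Pow {1..N + 1}. if N + 1 \<in> S then 0 else ?w S m) = (\<Sum>S\<in>Pow {1..N}. ?w S m)"
    unfolding A(2) by (subst sum_Pow_insert) (auto intro!: sum.cong)
  have "(\<Sum>S\<in>Pow {1..N + 1}. ?w (insert (N + 2) S) (Suc m)) =
      (\<Sum>S\<in>Pow {1..N + 1}. fps_X ^ (N + 2) * (?w S (Suc m) + (if N + 1 \<in> S then 0 else ?w S m)))"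
    by (intro sum.cong refl w)
  also have "\<dots> = fps_X ^ (N + 2) * (gap_fps (N + 1) (Suc m) + gap_fps N m)"
    by (simp only: sum_distrib_left[symmetric] sum.distrib drop gap_fps_def)
  finally have "(\<Sum>S\<in>Pow {1..N + 1}. ?w (insert (N + 2) S) (Suc m)) =
      fps_X ^ (N + 2) * (gap_fps (N + 1) (Suc m) + gap_fps N m)" .
  moreover have "gap_fps (N + 2) (Suc m) =
      gap_fps (N + 1) (Suc m) + (\<Sum>S\<in>Pow {1..N + 1}. ?w (insert (N + 2) S) (Suc m))"
    unfolding gap_fps_def A(1) by (rule sum_Pow_insert) auto
  ultimately show ?thesis by (simp add: algebra_simps)
qed

section \<open>Closed forms for the moments of order zero, one and two\<close>

lemma gap_fps_0: "gap_fps N 0 = (\<Prod>k=1..N. 1 + fps_X ^ k)"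
proof (induction N)
  case (Suc N)
  have A: "{1..Suc N} = insert (Suc N) {1..N}" by auto
  have "(\<Sum>S\<in>Pow {1..N}. fps_X ^ \<Sum>(insert (Suc N) S)) =
      (\<Sum>S\<in>Pow {1..N}. fps_X ^ Suc N * fps_X ^ \<Sum>S :: int fps)"
  proof (rule sum.cong)
    fix S assume "S \<in> Pow {1..N}"
    then have "finite S" "Suc N \<notin> S" using finite_subset by auto
    then show "fps_X ^ \<Sum>(insert (Suc N) S) = (fps_X ^ Suc N * fps_X ^ \<Sum>S :: int fps)"
      by (simp add: power_add)
  qed simp
  then have "gap_fps (Suc N) 0 = (1 + fps_X ^ Suc N) * gap_fps N 0"
    unfolding gap_fps_def A
    by (subst sum_Pow_insert) (auto simp: sum_distrib_left sum.distrib algebra_simps)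
  then show ?case using Suc by (simp add: mult.commute)
qed (simp add: gap_fps_def)

lemma gap_fps_le_1:
  assumes "N \<le> 1"
  shows "gap_fps N (Suc m) = 0"
proof -
  have "gap_starts S = 0" if "S \<subseteq> {1..N}" for S
  proof -
    have "{x \<in> S. x \<ge> 2 \<and> x - 1 \<notin> S} = {}" using that assms by fastforce
    then show ?thesis by (simp only: gap_starts_def card.empty)
  qed
  then show ?thesis by (simp add: gap_fps_def)
qed

lemma gap_fps_1:
  "(1 - fps_X ^ 2) * gap_fps (Suc N) 1 = fps_X ^ 2 * (1 - fps_X ^ N) * gap_fps N 0"
proof (induction N)
  case 0
  then show ?case using gap_fps_le_1[of 1 0] by simp
next
  case (Suc N)
  have rec: "gap_fps (Suc (Suc N)) 1 =
      (1 + fps_X ^ (N + 2)) * gap_fps (Suc N) 1 + fps_X ^ (N + 2) * gap_fps N 0"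
    using gap_fps_Suc_Suc[of N 0] by simp
  have Q: "gap_fps (Suc N) 0 = (1 + fps_X ^ Suc N) * gap_fps N 0"
    by (simp add: gap_fps_0 mult.commute)
  have "(1 - fps_X ^ 2) * gap_fps (Suc (Suc N)) 1 =
      (1 + fps_X ^ (N + 2)) * ((1 - fps_X ^ 2) * gap_fps (Suc N) 1)
      + (1 - fps_X ^ 2) * fps_X ^ (N + 2) * gap_fps N 0"
    unfolding rec by (simp add: algebra_simps)
  \<comment> \<open>Beside \<open>fps_X ^ 2 * gap_fps N 0\<close> the remaining factor collapses to
    \<open>1 - fps_X ^ (2 * N + 2)\<close>, a difference of squares.\<close>
  also have "\<dots> = fps_X ^ 2 * (1 - fps_X ^ Suc N) * gap_fps (Suc N) 0"
    unfolding Suc Q by (simp add: algebra_simps power_add power2_eq_square)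
  finally show ?case .
qed

text \<open>Induction along the recursion, with the first moment as its inhomogeneous term. The
  exponent 6 belongs to \<open>{2, 4}\<close>, the set of least sum with two gap starts; the shift
  to \<open>N + 3\<close> makes both sides vanish at \<open>N = 0\<close>.\<close>

lemma gap_fps_2:
  "(1 - fps_X ^ 2) * (1 - fps_X ^ 4) * gap_fps (N + 3) 2 =
    fps_X ^ 6 * (1 - fps_X ^ (N + 1)) * (1 - fps_X ^ N) * gap_fps (N + 1) 0"
proof (induction N)
  case 0
  have "gap_fps 2 2 = 0" "gap_fps 3 2 = (1 + fps_X ^ 3) * gap_fps 2 2 + fps_X ^ 3 * gap_fps 1 1"
    using gap_fps_Suc_Suc[of 0 1] gap_fps_Suc_Suc[of 1 1] gap_fps_le_1[of 1 1] gap_fps_le_1[of 0 0]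
    by (simp_all add: numeral_2_eq_2 numeral_3_eq_3)
  then show ?case using gap_fps_le_1[of 1 0] by simp
next
  case (Suc N)
  let ?X = "fps_X :: int fps"
  let ?Q = "gap_fps (N + 1) 0"
  have rec: "gap_fps (Suc N + 3) 2 =
      (1 + ?X ^ (N + 4)) * gap_fps (N + 3) 2 + ?X ^ (N + 4) * gap_fps (Suc (N + 1)) 1"
    using gap_fps_Suc_Suc[of "N + 2" 1] by (simp add: numeral_eq_Suc)
  have Q: "gap_fps (Suc N + 1) 0 = (1 + ?X ^ (N + 2)) * ?Q"
    by (simp add: gap_fps_0 mult.commute)
  have "(1 - ?X ^ 2) * (1 - ?X ^ 4) * gap_fps (Suc N + 3) 2 =
      (1 + ?X ^ (N + 4)) * ((1 - ?X ^ 2) * (1 - ?X ^ 4) * gap_fps (N + 3) 2)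
      + (1 - ?X ^ 4) * ?X ^ (N + 4) * ((1 - ?X ^ 2) * gap_fps (Suc (N + 1)) 1)"
    unfolding rec by (simp add: algebra_simps)
  also have "\<dots> = ((1 + ?X ^ 4 * ?X ^ N) * (?X ^ 6 * (1 - ?X * ?X ^ N) * (1 - ?X ^ N))
      + (1 - ?X ^ 4) * (?X ^ 4 * ?X ^ N) * (?X ^ 2 * (1 - ?X * ?X ^ N))) * ?Q"
    unfolding Suc gap_fps_1 by (simp add: power_add algebra_simps)
  \<comment> \<open>With \<open>t = ?X ^ N\<close>, the identity is \<open>(1 + ?X ^ 4 * t) * (1 -
    t) + (1 - ?X ^ 4) * t = 1 - ?X ^ 4 * t ^ 2\<close>.\<close>
  also have "\<dots> = ?X ^ 6 * (1 - ?X ^ 2 * ?X ^ N) * (1 - ?X * ?X ^ N) * (1 + ?X ^ 2 * ?X ^ N) * ?Q"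
    by algebra
  also have "\<dots> = ?X ^ 6 * (1 - ?X ^ (Suc N + 1)) * (1 - ?X ^ Suc N) * gap_fps (Suc N + 1) 0"
    unfolding Q by (simp add: power_add power2_eq_square algebra_simps)
  finally show ?case .
qed

section \<open>From generating functions to counts\<close>

lemma gap_fps_nth:
  "gap_fps N m $ n = int (\<Sum>S | S \<subseteq> {1..N} \<and> \<Sum>S = n. gap_starts S choose m)"
proof -
  have "gap_fps N m $ n = (\<Sum>S\<in>Pow {1..N}. if \<Sum>S = n then int (gap_starts S choose m) else 0)"
    by (auto simp: gap_fps_def fps_sum_nth fps_X_power_nth fps_of_nat[symmetric] intro!: sum.cong)
  also have "\<dots> = (\<Sum>S\<in>{S \<in> Pow {1..N}. \<Sum>S = n}. int (gap_starts S choose m))"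
    by (simp add: sum.If_cases Int_def conj_commute)
  finally show ?thesis by simp
qed

text \<open>The bound \<open>2 * n + 4\<close> is chosen so that the closed form contains the
  product up to \<open>2 * (n + 1)\<close>, which Euler's theorem with \<open>M = n + 1\<close>
  pairs with the odd factors up to \<open>2 * n + 1\<close>.\<close>

lemma sum_gap_starts_choose_2:
  fixes n :: nat
  defines "A \<equiv> {2, 4} \<union> (\<lambda>i. 2 * i + 1) ` {..n}"
  shows "(\<Sum>S | S \<subseteq> {1..2 * n + 4} \<and> \<Sum>S = n. gap_starts S choose 2) =
    (if n < 6 then 0 else card (parts_in A (n - 6)))"
proof -
  let ?X = "fps_X :: int fps"
  let ?E = "gap_fps (2 * n + 4) 2" and ?P = "parts_fps A"
  let ?O = "\<Prod>i<n + 1. 1 - ?X ^ (2 * i + 1)" and ?Q = "\<Prod>k=1..2 * (n + 1). 1 + ?X ^ k"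
  let ?w = "(1 - ?X ^ (2 * n + 2)) * (1 - ?X ^ (2 * n + 1)) * (?Q * ?O)"
  have inj: "inj_on (\<lambda>i. 2 * i + 1 :: nat) {..n}" by (auto simp: inj_on_def)
  have "{2, 4} \<inter> (\<lambda>i. 2 * i + 1 :: nat) ` {..n} = {}" by auto presburger+
  then have "(\<Prod>a\<in>A. 1 - ?X ^ a) = (\<Prod>a\<in>{2,4}. 1 - ?X ^ a) * (\<Prod>i\<le>n. 1 - ?X ^ (2 * i + 1))"
    unfolding A_def by (subst prod.union_disjoint) (simp_all only: prod.reindex[OF inj] o_def finite.intros finite_imageI finite_atMost)
  then have prodA: "(\<Prod>a\<in>A. 1 - ?X ^ a) = (1 - ?X ^ 2) * (1 - ?X ^ 4) * ?O"
    by (simp add: lessThan_Suc_atMost)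
  have "?P * (\<Prod>a\<in>A. 1 - ?X ^ a) = 1"
    by (rule parts_fps_times_prod) (auto simp: A_def)
  \<comment> \<open>Inserting this factor one supplies the denominators that the closed form needs,
    together with the odd factors for Euler's theorem.\<close>
  then have "?E * (?P * ((1 - ?X ^ 2) * (1 - ?X ^ 4) * ?O)) = ?E"
    unfolding prodA by (simp only: mult_1_right)
  then have "?E = (1 - ?X ^ 2) * (1 - ?X ^ 4) * ?E * (?O * ?P)"
    by (simp only: mult_ac)
  also have "(1 - ?X ^ 2) * (1 - ?X ^ 4) * ?E =
      ?X ^ 6 * (1 - ?X ^ (2 * n + 2)) * (1 - ?X ^ (2 * n + 1)) * ?Q"
    using gap_fps_2[of "2 * n + 1"] unfolding gap_fps_0 by (simp add: numeral_eq_Suc)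
  finally have E: "?E = (?X ^ 6 * ?P) * ?w" by (simp only: mult_ac)
  have "one_upto (n + 1) (?Q * ?O)"
  proof -
    have "one_upto (2 * (n + 1) + 1) (?Q * ?O)" by (rule Euler_odd_distinct)
    then show ?thesis
      unfolding one_upto_def by (rule dvd_trans[rotated]) (simp add: le_imp_power_dvd)
  qed
  moreover have "one_upto (n + 1) (1 - ?X ^ (2 * n + 2))" "one_upto (n + 1) (1 - ?X ^ (2 * n + 1))"
    by (rule one_upto_one_minus_X_power, simp)+
  ultimately have "one_upto (n + 1) ?w" by (metis one_upto_mult)
  then have "((?X ^ 6 * ?P) * ?w) $ n = (?X ^ 6 * ?P) $ n" by (rule one_upto_mult_nth) simp
  then have "int (\<Sum>S | S \<subseteq> {1..2 * n + 4} \<and> \<Sum>S = n. gap_starts S choose 2) =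
      int (if n < 6 then 0 else card (parts_in A (n - 6)))"
    unfolding E[symmetric] gap_fps_nth
    by (simp only: fps_X_power_mult_nth parts_fps_def fps_nth_Abs_fps if_distrib[of int] of_nat_0)
  then show ?thesis by (simp only: of_nat_eq_iff)
qed

text \<open>A partition into distinct parts is determined by its set of parts, and no part exceeds
  \<open>n\<close>, so every bound \<open>N\<close> from \<open>n\<close> on gives the same
  sum.\<close>

lemma sum_distinct_partitions:
  assumes "n \<le> N"
  shows "(\<Sum>p | is_partition n p \<and> distinct p. f (set p)) = (\<Sum>S | S \<subseteq> {1..N} \<and> \<Sum>S = n. f S)"
proof (rule sum.reindex_bij_witness[of _ "\<lambda>S. rev (sorted_list_of_set S)" set])
  fix p assume "p \<in> {p. is_partition n p \<and> distinct p}"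
  then have p: "sorted (rev p)" "0 \<notin> set p" "sum_list p = n" "distinct p"
    by (auto simp: is_partition_def sorted_wrt_rev)
  have "sorted_list_of_set (set (rev p)) = rev p"
    using p by (intro sorted_list_of_set.idem_if_sorted_distinct) auto
  then show "rev (sorted_list_of_set (set p)) = p" by simp
  have "x \<in> {1..N}" if "x \<in> set p" for x
    using p that member_le_sum_list[of x p] assms by (cases x) auto
  then show "set p \<in> {S. S \<subseteq> {1..N} \<and> \<Sum>S = n}"
    using p by (auto simp: sum_list_distinct_conv_sum_set[of p "\<lambda>x. x", simplified])
next
  fix S assume "S \<in> {S. S \<subseteq> {1..N} \<and> \<Sum>S = n}"
  then have S: "finite S" "0 \<notin> S" "\<Sum>S = n" by (auto intro: finite_subset)
  then show "set (rev (sorted_list_of_set S)) = S" by simp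
  have "sum_list (sorted_list_of_set S) = n"
    using S sum_list_distinct_conv_sum_set[of "sorted_list_of_set S" "\<lambda>x. x"] by simp
  then show "rev (sorted_list_of_set S) \<in> {p. is_partition n p \<and> distinct p}"
    using S by (auto simp: is_partition_def sorted_wrt_rev)
qed simp

lemma hook_count_2_distinct:
  assumes "is_partition n p" "distinct p"
  shows "hook_count 2 p = gap_starts (set p)"
proof -
  have "{x. count (mset p) x \<ge> 2} = {}" using assms(2) by (auto simp: distinct_count_atmost_1)
  then show ?thesis
    using assms hook_count_2[of p] by (simp add: is_partition_def gap_starts_def)
qed

subsection \<open>Partitions into odd parts\<close>

text \<open>The tagged sum keeps apart the two contributions of a repeated part of size at least 2.
  Pairs of cells can thus be counted as two-element sets of marks.\<close>

definition hook_marks :: "nat multiset \<Rightarrow> (nat + nat) set" where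
  "hook_marks K = {x \<in> set_mset K. x \<ge> 2} <+> {x. count K x \<ge> 2}"

lemma finite_hook_marks: "finite (hook_marks K)"
proof -
  have "{x. count K x \<ge> 2} \<subseteq> set_mset K"
    by (auto simp flip: count_greater_zero_iff)
  then have "finite {x. count K x \<ge> 2}" by (rule finite_subset) simp
  then show ?thesis by (simp add: hook_marks_def)
qed

text \<open>The predecessor of an odd part is even and hence never a part, so every part size from 2
  on contributes.\<close>

lemma hook_count_2_odd:
  assumes "is_partition n p" "\<forall>x\<in>set p. odd x"
  shows "hook_count 2 p = card (hook_marks (mset p))"
proof -
  have "finite {x. count (mset p) x \<ge> 2}"
    by (rule finite_subset[of _ "set p"]) (auto simp flip: count_greater_zero_iff set_mset_mset)
  moreover have "{x \<in> set p. x \<ge> 2 \<and> x - 1 \<notin> set p} = {x \<in> set p. x \<ge> 2}"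
  proof -
    have "x - 1 \<notin> set p" if "x \<in> set p" for x
    proof -
      have "even (x - 1)" using assms(2) that by simp
      then show ?thesis using assms(2) by blast
    qed
    then show ?thesis by blast
  qed
  ultimately show ?thesis
    using assms(1) hook_count_2[of p] by (simp add: is_partition_def hook_marks_def card_Plus)
qed

text \<open>
  The parts 2 and 4 encode an unordered pair of odd parts \<open>x \<le> y\<close>, both at least 3: the number of
  parts 4 is \<open>(x - 3) / 2\<close> and the number of parts 2 is \<open>(y - x) / 2\<close>.
\<close>

lemma card_parts_in_le:
  assumes "A \<subseteq> {2, 4} \<union> {x. odd x}"
  shows "card (parts_in A n) \<le>
    (\<Sum>p | is_partition (n + 6) p \<and> (\<forall>x\<in>set p. odd x). hook_count 2 p choose 2)"
proof -
  let ?O = "{p. is_partition (n + 6) p \<and> (\<forall>x\<in>set p. odd x)}"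
  let ?pairs = "\<lambda>p. {T. T \<subseteq> hook_marks (mset p) \<and> card T = 2}"
  \<comment> \<open>The sum \<open>x K + y K\<close> is 6 plus the total of the parts 2 and 4, which
    accounts for the shift from \<open>n\<close> to \<open>n + 6\<close>.\<close>
  define x where "x K = 3 + 2 * count K 4" for K :: "nat multiset"
  define y where "y K = x K + 2 * count K 2" for K :: "nat multiset"
  define odds where "odds K = filter_mset odd K" for K :: "nat multiset"
  define f where "f K = rev (sorted_list_of_multiset (odds K + {#x K, y K#}))" for K
  \<comment> \<open>If the two new parts coincide, their common value is repeated in
    \<open>f K\<close> and so carries both kinds of mark.\<close>
  define g where "g K = (if x K = y K then {Inl (x K), Inr (x K)} else {Inl (x K), Inl (y K)})"
    for K :: "nat multiset"
  have mset_f: "mset (f K) = odds K + {#x K, y K#}" for K by (simp add: f_def)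
  have decomp: "K = odds K + replicate_mset (count K 2) 2 + replicate_mset (count K 4) 4"
    if "K \<in> parts_in A n" for K
  proof (rule multiset_eqI)
    fix z
    have "z \<in> {2, 4} \<union> {x. odd x} \<or> count K z = 0"
      using that assms by (auto simp: parts_in_def count_eq_zero_iff)
    then show "count K z =
      count (odds K + replicate_mset (count K 2) 2 + replicate_mset (count K 4) 4) z"
      by (auto simp: odds_def)
  qed
  have "inj_on (\<lambda>K. (f K, g K)) (parts_in A n)"
  proof (rule inj_onI)
    fix K L assume K: "K \<in> parts_in A n" and L: "L \<in> parts_in A n"
      and eq: "(f K, g K) = (f L, g L)"
    have le: "x K \<le> y K" "x L \<le> y L" by (auto simp: y_def)
    \<comment> \<open>The tags tell the two cases apart, and \<open>x K \<le> y K\<close> orders the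
      pair. Removing it from \<open>f K\<close> then leaves the original odd parts.\<close>
    have xy: "x K = x L" "y K = y L"
      using eq le by (auto simp: g_def doubleton_eq_iff split: if_splits)
    then have "count K 4 = count L 4" "count K 2 = count L 2" by (auto simp: x_def y_def)
    moreover have "odds K = odds L"
      using mset_f[of K] mset_f[of L] eq xy by simp
    ultimately show "K = L" using decomp[OF K] decomp[OF L] by metis
  qed
  moreover have "(\<lambda>K. (f K, g K)) ` parts_in A n \<subseteq> Sigma ?O ?pairs"
  proof (rule image_subsetI, rule SigmaI)
    fix K assume K: "K \<in> parts_in A n"
    have "sum_mset K = sum_mset (odds K) + 2 * count K 2 + 4 * count K 4"
      by (subst decomp[OF K]) (simp add: odds_def)
    then have "sum_mset (odds K + {#x K, y K#}) = n + 6"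
      using K by (simp add: parts_in_def x_def y_def)
    then have "sum_list (f K) = n + 6" by (metis mset_f sum_mset_sum_list)
    moreover have "\<forall>z\<in>set (f K). odd z"
    proof -
      have "\<forall>z\<in>#mset (f K). odd z" unfolding mset_f by (auto simp: odds_def x_def y_def)
      then show ?thesis by simp
    qed
    moreover have "sorted_wrt (\<ge>) (f K)" by (simp add: f_def sorted_wrt_rev sorted_insort)
    ultimately show "f K \<in> ?O" by (auto simp: is_partition_def)
    show "g K \<in> ?pairs (f K)"
      unfolding mset_f by (auto simp: g_def hook_marks_def x_def y_def)
  qed
  moreover have finO: "finite ?O" by (rule finite_subset[OF _ finite_partitions]) auto
  moreover have "finite (?pairs p)" for p
    by (rule finite_subset[of _ "Pow (hook_marks (mset p))"]) (auto simp: finite_hook_marks)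
  ultimately have "card (parts_in A n) \<le> card (Sigma ?O ?pairs)"
    by (intro card_inj_on_le) auto
  also have "\<dots> = (\<Sum>p\<in>?O. card (?pairs p))"
    using finO \<open>\<And>p. finite (?pairs p)\<close> by (intro card_SigmaI) auto
  also have "\<dots> = (\<Sum>p\<in>?O. hook_count 2 p choose 2)"
    by (intro sum.cong) (auto simp: n_subsets finite_hook_marks hook_count_2_odd)
  finally show ?thesis .
qed

section \<open>Series over hook counts as sums over partitions\<close>

text \<open>Only values of \<open>h\<close> on the finite set \<open>S\<close> give nonzero terms,
  and grouping \<open>S\<close> by these values gives the sum.\<close>

lemma suminf_mult_card_fibre:
  fixes f h :: "_ \<Rightarrow> nat"
  assumes "finite S"
  shows "(\<Sum>m. f m * card {p \<in> S. h p = m}) = (\<Sum>p\<in>S. f (h p))"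
proof -
  have "(\<Sum>m. f m * card {p \<in> S. h p = m}) = (\<Sum>m\<in>h ` S. f m * card {p \<in> S. h p = m})"
  proof (rule suminf_finite)
    fix m assume "m \<notin> h ` S"
    then have "{p \<in> S. h p = m} = {}" by auto
    then show "f m * card {p \<in> S. h p = m} = 0" by (simp only: card.empty)
  qed (use assms in simp)
  also have "\<dots> = (\<Sum>m\<in>h ` S. \<Sum>p | p \<in> S \<and> h p = m. f (h p))"
    by (intro sum.cong) auto
  also have "\<dots> = (\<Sum>p\<in>S. f (h p))"
    by (rule sum.image_gen[OF assms, symmetric])
  finally show ?thesis .
qed

theorem theorem2p9:
  fixes n :: nat
  shows "(\<Sum>m. (m choose 2) * a2 m n) \<ge> (\<Sum>m. (m choose 2) * b2 m n)"
proof -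
  let ?O = "{p. is_partition n p \<and> (\<forall>x\<in>set p. odd x)}"
  let ?D = "{p. is_partition n p \<and> distinct p}"
  let ?A = "{2, 4} \<union> (\<lambda>i. 2 * i + 1) ` {..n}"
  have fin: "finite ?O" "finite ?D"
    by (rule finite_subset[OF _ finite_partitions]; auto)+
  have "(\<Sum>m. (m choose 2) * b2 m n) = (\<Sum>p\<in>?D. hook_count 2 p choose 2)"
    using suminf_mult_card_fibre[OF fin(2), of "\<lambda>m. m choose 2" "hook_count 2"]
    by (simp add: b2_def conj_assoc)
  also have "\<dots> = (\<Sum>p\<in>?D. gap_starts (set p) choose 2)"
    by (intro sum.cong) (auto simp: hook_count_2_distinct)
  also have "\<dots> = (\<Sum>S | S \<subseteq> {1..2 * n + 4} \<and> \<Sum>S = n. gap_starts S choose 2)"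
    by (rule sum_distinct_partitions) simp
  also have "\<dots> = (if n < 6 then 0 else card (parts_in ?A (n - 6)))"
    by (rule sum_gap_starts_choose_2)
  also have "\<dots> \<le> (\<Sum>p\<in>?O. hook_count 2 p choose 2)"
  proof (cases "n < 6")
    case False
    have "?A \<subseteq> {2, 4} \<union> {x. odd x}" by auto
    from card_parts_in_le[OF this, of "n - 6"] show ?thesis using False by simp
  qed simp
  also have "\<dots> = (\<Sum>m. (m choose 2) * a2 m n)"
    using suminf_mult_card_fibre[OF fin(1), of "\<lambda>m. m choose 2" "hook_count 2"]
    by (simp add: a2_def conj_assoc)
  finally show ?thesis .
qed

end
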